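(* Let $h$ be a positive integer and let $q$ be a power of a prime $p$ with $p\ge h$. Let $\boldsymbol{\alpha}=(\alpha_1,\dots,\alpha_n)$, where $\alpha_1,\dots,\alpha_n$ are distinct elements of $\Lambda_{h,q}$, let $\mathbf{t}=(t_1,\dots,t_m)$, where $t_1,\dots,t_m$ are distinct elements of $\mathbb{F}_q$, let $\omega$ be a normal element of $\mathbb{F}_{q^h}$ over $\mathbb{F}_q$, and let $k$ be an integer with $1\le k<n$ and $q\ge hk+1$. Then the code $$\mathcal{S}_{h,k,q}(\boldsymbol{\alpha},\mathbf{t},\infty):=\Bigl\{\Bigl(f(\alpha_1),\dots,f(\alpha_n),\ \sum_{i=0}^{h-1}f^{(i)}(t_1)\omega^{q^i},\dots,\sum_{i=0}^{h-1}f^{(i)}(t_m)\omega^{q^i},\ f(\overline{\infty})\Bigr): f(x)\in\mathbb{F}_q[x],\ \deg f<hk\Bigr\}\subseteq\mathbb{F}_{q^h}^{n+m+1},$$ where $f(\overline{\infty}):=\sum_{i=0}^{h-1}f_{hk-h+i}\,\omega^{q^i}$ for $f(x)=\sum_{j=0}^{hk-1}f_jx^j$, is an additive MDS code.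
   Context: $\Lambda_{h,q}$ is a set of representatives of the orbits of size $h$ of $\mathbb{F}_{q^h}$ under the $q$-Frobenius automorphism $x\mapsto x^q$ (so each $\alpha\in\Lambda_{h,q}$ satisfies $\mathbb{F}_q(\alpha)=\mathbb{F}_{q^h}$, and distinct elements lie in distinct Frobenius orbits). $f^{(i)}$ denotes the $i$-th formal derivative of $f$. An element $\omega$ is normal if $\omega,\omega^q,\dots,\omega^{q^{h-1}}$ is an $\mathbb{F}_q$-basis of $\mathbb{F}_{q^h}$. A code in $\mathbb{F}_{q^h}^N$ is additive if it is closed under addition. An $\mathbb{F}_q$-linear code in $\mathbb{F}_{q^h}^N$ of $\mathbb{F}_q$-dimension $K$ and minimum Hamming distance $d$ satisfies the Singleton bound $q^K\le q^{h(N-d+1)}$; it is MDS if equality holds.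
   Formalization: For h = 1 it is additionally assumed that no α_i equals any t_j; without this the claim fails (q = 5, h = 1, k = 2, α = (0,1,2), t = (0), f = x gives weight 3 instead of 4). For h ≥ 2 nothing is added. *)

theory Defs
  imports
    "HOL-Computational_Algebra.Polynomial"
    "HOL-Computational_Algebra.Primes"
    "HOL-Combinatorics.Orbits"
    "HOL-Library.Function_Algebras"
    "HOL-Library.Cardinality"
    "Subresultants.More_Homomorphisms"
begin

text \<open>
  The extension of finite fields is given by a field homomorphism \<open>\<iota> :: 'k \<Rightarrow> 'a\<close>, where
  \<open>'k\<close> plays the role of \<open>F_q\<close> and \<open>'a\<close> the role of \<open>F_(q^h)\<close>.  Linear algebra over \<open>F_q\<close> is
  that of the library locales \<^locale>\<open>module\<close> and \<^locale>\<open>vector_space\<close>, instantiated with the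
  scalar multiplications below.
\<close>

definition ext_scale :: "('k \<Rightarrow> 'a) \<Rightarrow> 'k::field \<Rightarrow> 'a::field \<Rightarrow> 'a" where
  "ext_scale \<iota> c x = \<iota> c * x"

definition word_scale :: "('k \<Rightarrow> 'a) \<Rightarrow> 'k::field \<Rightarrow> (nat \<Rightarrow> 'a::field) \<Rightarrow> nat \<Rightarrow> 'a" where
  "word_scale \<iota> c v = (\<lambda>i. ext_scale \<iota> c (v i))"

lemma vector_space_ext_scale:
  assumes "field_hom \<iota>"
  shows "vector_space (ext_scale \<iota>)"
proof -
  interpret field_hom \<iota> by (fact assms)
  show ?thesis
    by unfold_locales (auto simp: ext_scale_def algebra_simps hom_add hom_mult)
qed

lemma vector_space_word_scale:
  assumes "field_hom \<iota>"
  shows "vector_space (word_scale \<iota>)"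
proof -
  interpret field_hom \<iota> by (fact assms)
  show ?thesis
    by unfold_locales
      (auto simp: word_scale_def ext_scale_def fun_eq_iff algebra_simps hom_add hom_mult)
qed

text \<open>
  A set of representatives of the Frobenius orbits of size \<open>h\<close>.  The library's \<^const>\<open>orbit\<close>
  collects the iterates with positive exponent; as the Frobenius map is a permutation of a
  finite field, this is the usual orbit and contains its starting point.
\<close>

definition frobenius_reps :: "nat \<Rightarrow> nat \<Rightarrow> ('a::{field,finite}) set \<Rightarrow> bool" where
  "frobenius_reps q h \<Lambda> \<longleftrightarrow>
     (\<forall>x\<in>\<Lambda>. card (orbit (\<lambda>y. y ^ q) x) = h) \<and>
     (\<forall>x. card (orbit (\<lambda>y. y ^ q) x) = h \<longrightarrow> (\<exists>!r. r \<in> \<Lambda> \<and> r \<in> orbit (\<lambda>y. y ^ q) x))"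

definition normal_element ::
  "('k::{field,finite} \<Rightarrow> 'a::{field,finite}) \<Rightarrow> nat \<Rightarrow> 'a \<Rightarrow> bool" where
  "normal_element \<iota> h \<omega> \<longleftrightarrow>
     inj_on (\<lambda>i. \<omega> ^ (CARD('k) ^ i)) {..<h} \<and>
     \<not> module.dependent (ext_scale \<iota>) ((\<lambda>i. \<omega> ^ (CARD('k) ^ i)) ` {..<h}) \<and>
     module.span (ext_scale \<iota>) ((\<lambda>i. \<omega> ^ (CARD('k) ^ i)) ` {..<h}) = UNIV"

text \<open>
  A word of length \<open>N\<close> is a function on \<^typ>\<open>nat\<close> that vanishes outside \<open>{..<N}\<close>; addition of
  words is pointwise addition of functions.
\<close>

definition words :: "nat \<Rightarrow> (nat \<Rightarrow> 'a::zero) set" where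
  "words N = {v. \<forall>i\<ge>N. v i = 0}"

definition hamming_dist :: "nat \<Rightarrow> (nat \<Rightarrow> 'a) \<Rightarrow> (nat \<Rightarrow> 'a) \<Rightarrow> nat" where
  "hamming_dist N u v = card {i. i < N \<and> u i \<noteq> v i}"

definition min_dist :: "nat \<Rightarrow> (nat \<Rightarrow> 'a) set \<Rightarrow> nat" where
  "min_dist N C = Min {hamming_dist N u v | u v. u \<in> C \<and> v \<in> C \<and> u \<noteq> v}"

definition additive_code :: "nat \<Rightarrow> (nat \<Rightarrow> 'a::monoid_add) set \<Rightarrow> bool" where
  "additive_code N C \<longleftrightarrow> C \<noteq> {} \<and> C \<subseteq> words N \<and> (\<forall>u\<in>C. \<forall>v\<in>C. u + v \<in> C)"

text \<open>
  The zero code is excluded since it has no minimum distance.  The subtraction in \<open>N - d + 1\<close>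
  does not truncate, as \<open>d \<le> N\<close>.
\<close>

definition mds_code ::
  "('k::{field,finite} \<Rightarrow> 'a::{field,finite}) \<Rightarrow> nat \<Rightarrow> nat \<Rightarrow> (nat \<Rightarrow> 'a) set \<Rightarrow> bool" where
  "mds_code \<iota> h N C \<longleftrightarrow>
     C \<subseteq> words N \<and> C \<noteq> {0} \<and> module.subspace (word_scale \<iota>) C \<and>
     CARD('k) ^ vector_space.dim (word_scale \<iota>) C = CARD('k) ^ (h * (N - min_dist N C + 1))"

text \<open>
  The points \<open>\<alpha>_1, \<dots>, \<alpha>_n\<close> and \<open>t_1, \<dots>, t_m\<close> are indexed from \<open>0\<close> here.  The coordinates
  \<open>0, \<dots>, n - 1\<close> belong to the former, \<open>n, \<dots>, n + m - 1\<close> to the latter, and \<open>n + m\<close> to infinity.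
\<close>

definition S_word ::
  "('k::{field,finite} \<Rightarrow> 'a::{field,finite}) \<Rightarrow> nat \<Rightarrow> nat \<Rightarrow> nat \<Rightarrow> nat \<Rightarrow>
   (nat \<Rightarrow> 'a) \<Rightarrow> (nat \<Rightarrow> 'k) \<Rightarrow> 'a \<Rightarrow> 'k poly \<Rightarrow> nat \<Rightarrow> 'a" where
  "S_word \<iota> h k n m \<alpha> t \<omega> f = (\<lambda>j.
     if j < n then poly (map_poly \<iota> f) (\<alpha> j)
     else if j < n + m then
       (\<Sum>i<h. \<iota> (poly ((pderiv ^^ i) f) (t (j - n))) * \<omega> ^ (CARD('k) ^ i))
     else if j = n + m then
       (\<Sum>i<h. \<iota> (coeff f (h * k - h + i)) * \<omega> ^ (CARD('k) ^ i))
     else 0)"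

definition S_code ::
  "('k::{field,finite} \<Rightarrow> 'a::{field,finite}) \<Rightarrow> nat \<Rightarrow> nat \<Rightarrow> nat \<Rightarrow> nat \<Rightarrow>
   (nat \<Rightarrow> 'a) \<Rightarrow> (nat \<Rightarrow> 'k) \<Rightarrow> 'a \<Rightarrow> (nat \<Rightarrow> 'a) set" where
  "S_code \<iota> h k n m \<alpha> t \<omega> = {S_word \<iota> h k n m \<alpha> t \<omega> f | f. degree f < h * k}"

end

theory Submission
  imports Defs
begin

text \<open>
  A nonzero polynomial \<open>f\<close> over \<open>F_q\<close> of degree less than \<open>h k\<close> makes fewer than \<open>k\<close> coordinates
  vanish, since each vanishing coordinate costs \<open>h\<close> from the budget \<open>h k\<close>. If \<open>f(\<alpha>_j) = 0\<close>, then
  \<open>f\<close> vanishes at all \<open>h\<close> conjugates of \<open>\<alpha>_j\<close>. The conjugates of a normal element are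
  independent, so a coordinate at \<open>t_j\<close> vanishes only if \<open>f, f', \<dots>, f^(h-1)\<close> all vanish at \<open>t_j\<close>;
  because \<open>h \<le> p\<close>, the factorials below \<open>h\<close> are units and \<open>t_j\<close> is a zero of multiplicity at least
  \<open>h\<close>. For the same reason of independence, the coordinate at infinity vanishes only if the \<open>h\<close> top
  coefficients do, which lowers the bound on the degree by \<open>h\<close>. The conjugates of different
  \<open>\<alpha>_j\<close> and the points \<open>t_j\<close> are pairwise distinct, so counting zeros with multiplicity gives
  the claim (\<open>card_zeros_S_word_less\<close>).

  Hence two codewords from different polynomials agree in at most \<open>k - 1\<close> of the \<open>N\<close> coordinates.
  Encoding is therefore injective, the code has \<open>q^(h k)\<close> words, and its minimum distance is
  at least \<open>N - k + 1\<close>. By the pigeonhole principle on the first \<open>k - 1\<close> coordinates it is no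
  larger (\<open>min_dist_eqI_Singleton\<close>). The dimension is read off from the number of words
  (\<open>card_subspace_eq_power_dim\<close>), so no basis of the code has to be exhibited.
\<close>

section \<open>Finite fields and the Frobenius map\<close>

text \<open>
  Translation by \<open>1\<close> permutes the field, so summing all elements in two ways shows that
  the characteristic divides the cardinality.
\<close>

lemma CHAR_of_CARD_prime_power:
  assumes "prime p" and "CARD('a::{field,finite}) = p ^ d"
  shows "CHAR('a) = p"
proof -
  have "prime (CHAR('a))"
    using finite_imp_CHAR_pos[where ?'a = 'a] by (simp add: prime_CHAR_semidom)
  moreover have "CHAR('a) dvd p ^ d"
  proof -
    have "(\<Sum>x\<in>UNIV. x + 1 :: 'a) = (\<Sum>x\<in>UNIV. x)"
      by (rule sum.reindex_bij_witness[of _ "\<lambda>x. x - 1" "\<lambda>x. x + 1"]) auto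
    then have "of_nat CARD('a) = (0 :: 'a)"
      by (simp add: sum.distrib)
    then show ?thesis
      by (simp add: of_nat_eq_0_iff_char_dvd assms(2) flip: of_nat_power)
  qed
  ultimately show ?thesis
    using assms(1) prime_dvd_power primes_dvd_imp_eq by blast
qed

text \<open>
  Fermat's little theorem for finite fields: multiplication by \<open>x \<noteq> 0\<close> permutes the nonzero
  elements, hence leaves their product unchanged.
\<close>

lemma power_CARD_eq_self:
  fixes x :: "'a::{field,finite}"
  shows "x ^ CARD('a) = x"
proof (cases "x = 0")
  case False
  have "x * (\<Prod>y\<in>UNIV-{0}. x * y) = x * x ^ (CARD('a) - 1) * (\<Prod>y\<in>UNIV-{0}. y)"
    by (simp add: prod.distrib mult_ac)
  moreover have "(\<Prod>y\<in>UNIV-{0}. x * y) = (\<Prod>y\<in>UNIV-{0}. y)"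
    by (rule prod.reindex_bij_witness[of _ "\<lambda>y. y / x" "\<lambda>y. x * y"]) (use False in auto)
  ultimately have "x * x ^ (CARD('a) - 1) = x"
    by simp
  moreover have "CARD('a) = Suc (CARD('a) - 1)"
    by simp
  ultimately show ?thesis
    by (metis power_Suc)
qed (simp add: power_0_left)

text \<open>
  That the Frobenius map is a permutation makes every point a member of its own \<^const>\<open>orbit\<close>,
  which is defined by the iterates with positive exponent.
\<close>

lemma permutation_frobenius:
  assumes "prime p" and "CARD('a::{field,finite}) = p ^ d"
  shows "permutation (\<lambda>y::'a. y ^ (p ^ e))"
proof -
  have char: "CHAR('a) = p"
    using assms by (rule CHAR_of_CARD_prime_power)
  have "inj (\<lambda>y::'a. y ^ (p ^ e))"
  proof (rule injI)
    fix x y :: 'a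
    assume eq: "x ^ (p ^ e) = y ^ (p ^ e)"
    have "((x - y) + y) ^ (p ^ e) = (x - y) ^ (p ^ e) + y ^ (p ^ e)"
      by (rule freshmans_dream') (simp_all add: char assms(1))
    with eq show "x = y"
      by simp
  qed
  then show ?thesis
    by (simp add: permutation bij_def finite_UNIV_inj_surj)
qed

text \<open>
  The \<open>q\<close>-Frobenius map is additive and fixes the coefficients of a polynomial over \<open>F_q\<close>, so it
  commutes with evaluation and sends roots to roots.
\<close>

lemma poly_map_poly_frobenius_orbit:
  fixes \<iota> :: "'k::{field,finite} \<Rightarrow> 'a::{field,finite}"
  assumes "field_hom \<iota>" and "prime p" and "CARD('k) = p ^ e" and "CARD('a) = p ^ d"
    and root: "poly (map_poly \<iota> f) x = 0"
    and y: "y \<in> orbit (\<lambda>y. y ^ CARD('k)) x"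
  shows "poly (map_poly \<iota> f) y = 0"
proof -
  interpret field_hom \<iota> by (fact assms(1))
  have char: "CHAR('a) = p"
    using assms(2,4) by (rule CHAR_of_CARD_prime_power)
  have coeff: "\<iota> c ^ CARD('k) = \<iota> c" for c
    by (metis hom_power power_CARD_eq_self)
  have frob: "poly (map_poly \<iota> f) (z ^ CARD('k)) = poly (map_poly \<iota> f) z ^ CARD('k)" for z
  proof -
    have "poly (map_poly \<iota> f) z ^ CARD('k)
        = (\<Sum>i\<le>degree (map_poly \<iota> f). (coeff (map_poly \<iota> f) i * z ^ i) ^ CARD('k))"
      unfolding poly_altdef
      by (rule freshmans_dream_sum'[where n = e]) (simp_all add: char assms(2,3))
    also have "\<dots> = poly (map_poly \<iota> f) (z ^ CARD('k))"
      unfolding poly_altdef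
      by (intro sum.cong) (simp_all add: power_mult_distrib coeff power_commutes mult.commute
          flip: power_mult)
    finally show ?thesis
      by simp
  qed
  from y show ?thesis
    by induction (simp_all add: frob root)
qed

section \<open>Multiple zeros in small positive characteristic\<close>

lemma of_nat_fact_neq_0_below_CHAR:
  assumes "i < CHAR('a::idom)"
  shows "(of_nat (fact i) :: 'a) \<noteq> 0"
  using assms
proof (induction i)
  case (Suc i)
  then have "\<not> CHAR('a) dvd Suc i"
    by (auto dest: dvd_imp_le)
  then have "(of_nat (Suc i) :: 'a) \<noteq> 0"
    by (simp only: of_nat_eq_0_iff_char_dvd not_False_eq_True)
  moreover have "(of_nat (fact i) :: 'a) \<noteq> 0"
    using Suc by simp
  ultimately show ?case
    by (simp only: fact_Suc of_nat_mult mult_eq_0_iff of_nat_id) simp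
qed simp

text \<open>
  By the product rule, one derivative turns \<open>(x - a)^(j+1) g\<close> into
  \<open>(x - a)^j ((j + 1) g + (x - a) g')\<close>, whose second factor has the value \<open>(j + 1) g(a)\<close> at \<open>a\<close>.
\<close>

lemma poly_higher_pderiv_linear_power_mult:
  fixes g :: "'a::idom poly"
  shows "poly ((pderiv ^^ j) ([:-a, 1:] ^ j * g)) a = of_nat (fact j) * poly g a"
proof (induction j arbitrary: g)
  case (Suc j)
  have "pderiv ([:-a, 1:] ^ Suc j * g)
      = [:-a, 1:] ^ j * (Polynomial.smult (of_nat (Suc j)) g + [:-a, 1:] * pderiv g)"
    by (simp only: pderiv_mult pderiv_power_Suc)
      (simp add: pderiv_pCons algebra_simps smult_add_left smult_add_right)
  then show ?case
    by (simp only: funpow_Suc_right comp_apply Suc.IH)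
      (simp add: algebra_simps)
qed simp

text \<open>
  If \<open>f = (x - a)^h g\<close>, then the \<open>h\<close>-th derivative has the value \<open>h! g(a)\<close> at \<open>a\<close>, which determines
  whether \<open>g(a) = 0\<close> as long as \<open>h\<close> is below the characteristic. Beyond it multiplicity is no longer
  detected: in characteristic \<open>p\<close>, all formal derivatives of \<open>x^p\<close> vanish at \<open>0\<close>.
\<close>

lemma linear_power_dvdI_higher_pderiv:
  fixes f :: "'a::idom poly"
  assumes zero: "\<And>i. i < h \<Longrightarrow> poly ((pderiv ^^ i) f) a = 0" and "h \<le> CHAR('a)"
  shows "[:-a, 1:] ^ h dvd f"
  using assms
proof (induction h)
  case (Suc h)
  then obtain g where g: "f = [:-a, 1:] ^ h * g"
    by auto
  have "of_nat (fact h) * poly g a = 0"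
    using Suc.prems(1)[of h] by (simp only: g poly_higher_pderiv_linear_power_mult)
  moreover have "(of_nat (fact h) :: 'a) \<noteq> 0"
    using Suc.prems(2) by (intro of_nat_fact_neq_0_below_CHAR) simp
  ultimately have "[:-a, 1:] dvd g"
    by (simp add: poly_eq_0_iff_dvd)
  then show ?case
    unfolding g power_Suc2 by (rule mult_dvd_mono[OF dvd_refl])
qed simp

section \<open>Counting\<close>

text \<open>
  A basis identifies the subspace with the coefficient functions on that basis.
\<close>

lemma (in vector_space) card_subspace_eq_power_dim:
  assumes "finite (UNIV :: 'a set)" and "finite V" and "subspace V"
  shows "card V = CARD('a) ^ dim V"
proof -
  obtain B where B: "B \<subseteq> V" "independent B" "V \<subseteq> span B" "card B = dim V"
    by (rule basis_exists)
  have fin: "finite B"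
    using B(1) assms(2) by (rule finite_subset)
  have V: "V = span B"
    using B(1,3) assms(3) span_minimal by blast
  let ?comb = "\<lambda>c. \<Sum>b\<in>B. c b *s b"
  have "bij_betw ?comb (B \<rightarrow>\<^sub>E UNIV) V"
    unfolding bij_betw_def
  proof
    show "inj_on ?comb (B \<rightarrow>\<^sub>E UNIV)"
    proof (rule inj_onI)
      fix c d
      assume c: "c \<in> B \<rightarrow>\<^sub>E UNIV" and d: "d \<in> B \<rightarrow>\<^sub>E UNIV" and eq: "?comb c = ?comb d"
      have "(\<Sum>b\<in>B. (c b - d b) *s b) = 0"
        using eq by (simp add: scale_left_diff_distrib sum_subtractf)
      then have "c b - d b = 0" if "b \<in> B" for b
        using independentD[OF B(2) fin subset_refl _ that, of "\<lambda>b. c b - d b"] by simp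
      then show "c = d"
        by (intro PiE_ext[OF c d]) simp
    qed
    show "?comb ` (B \<rightarrow>\<^sub>E UNIV) = V"
    proof
      show "V \<subseteq> ?comb ` (B \<rightarrow>\<^sub>E UNIV)"
      proof
        fix v assume "v \<in> V"
        then obtain c where "v = ?comb c"
          unfolding V span_finite[OF fin] by blast
        then have "v = ?comb (restrict c B)"
          by simp
        then show "v \<in> ?comb ` (B \<rightarrow>\<^sub>E UNIV)"
          by (rule image_eqI[of _ ?comb]) (rule restrict_PiE_iff[THEN iffD2], simp)
      qed
    qed (auto simp: V intro!: span_sum intro: span_scale span_base)
  qed
  then have "card V = card (B \<rightarrow>\<^sub>E (UNIV :: 'a set))"
    by (simp add: bij_betw_same_card)
  then show ?thesis
    by (simp add: card_PiE fin B(4))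
qed

lemma card_degree_less:
  assumes "N > 0"
  shows "card {f :: 'k::{field,finite} poly. degree f < N} = CARD('k) ^ N"
    and "finite {f :: 'k poly. degree f < N}"
proof -
  have "bij_betw (\<lambda>f. restrict (coeff f) {..<N}) {f :: 'k poly. degree f < N}
      ({..<N} \<rightarrow>\<^sub>E UNIV)"
  proof (rule bij_betw_byWitness[where f' = "\<lambda>c. \<Sum>i<N. monom (c i) i"])
    show "\<forall>f\<in>{f :: 'k poly. degree f < N}.
        (\<Sum>i<N. monom (restrict (coeff f) {..<N} i) i) = f"
      by (auto simp: poly_eq_iff coeff_sum if_distrib not_less coeff_eq_0 cong: if_cong)
    show "\<forall>c\<in>{..<N} \<rightarrow>\<^sub>E UNIV. restrict (coeff (\<Sum>i<N. monom (c i :: 'k) i)) {..<N} = c"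
    proof
      fix c assume c: "c \<in> {..<N} \<rightarrow>\<^sub>E (UNIV :: 'k set)"
      show "restrict (coeff (\<Sum>i<N. monom (c i) i)) {..<N} = c"
        by (rule PiE_ext[OF _ c]) (auto simp: coeff_sum)
    qed
    show "(\<lambda>c. \<Sum>i<N. monom (c i :: 'k) i) ` ({..<N} \<rightarrow>\<^sub>E UNIV) \<subseteq> {f. degree f < N}"
      using assms
      by (auto intro!: degree_sum_less intro: le_less_trans[OF degree_monom_le])
  qed (auto split: if_splits)
  note this
  then show "card {f :: 'k poly. degree f < N} = CARD('k) ^ N"
    and "finite {f :: 'k poly. degree f < N}"
    by (auto simp: bij_betw_same_card card_PiE bij_betw_finite finite_PiE)
qed

lemma hamming_dist_eq_diff_agreements:
  "hamming_dist N u v = N - card {i. i < N \<and> u i = v i}"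
proof -
  have "{i. i < N \<and> u i \<noteq> v i} = {..<N} - {i. i < N \<and> u i = v i}"
    by auto
  then show ?thesis
    unfolding hamming_dist_def by (simp add: card_Diff_subset subset_eq)
qed

text \<open>
  The case of equality in the Singleton bound, for arbitrary codes: there are more
  words than patterns on the first \<open>k - 1\<close> coordinates, so two words agree on all of these, and
  by hypothesis nowhere else.
\<close>

lemma min_dist_eqI_Singleton:
  fixes C :: "(nat \<Rightarrow> 'a::{zero,finite}) set"
  assumes "CARD('a) > 1" and "finite C" and "1 \<le> k" and "k \<le> N" and "card C = CARD('a) ^ k"
    and agree: "\<And>u v. u \<in> C \<Longrightarrow> v \<in> C \<Longrightarrow> u \<noteq> v \<Longrightarrow> card {i. i < N \<and> u i = v i} < k"
  shows "min_dist N C = N - k + 1"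
proof -
  let ?D = "{hamming_dist N u v | u v. u \<in> C \<and> v \<in> C \<and> u \<noteq> v}"
  have "\<not> inj_on (\<lambda>u. restrict u {..<k - 1}) C"
  proof
    assume "inj_on (\<lambda>u. restrict u {..<k - 1}) C"
    then have "card C \<le> card ({..<k - 1} \<rightarrow>\<^sub>E (UNIV :: 'a set))"
      by (rule card_inj_on_le) (auto intro!: finite_PiE split: if_splits)
    then have "CARD('a) ^ k \<le> CARD('a) ^ (k - 1)"
      by (simp add: card_PiE assms(5))
    then show False
      using power_le_imp_le_exp[of "CARD('a)" k "k - 1"] assms(1,3) by simp
  qed
  then obtain u v where uv: "u \<in> C" "v \<in> C" "u \<noteq> v"
    and eq: "restrict u {..<k - 1} = restrict v {..<k - 1}"
    by (auto simp: inj_on_def)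
  have "u i = v i" if "i < k - 1" for i
    using fun_cong[OF eq, of i] that by simp
  then have "{..<k - 1} \<subseteq> {i. i < N \<and> u i = v i}"
    using assms(4) by auto
  then have "k - 1 \<le> card {i. i < N \<and> u i = v i}"
    using card_mono[of "{i. i < N \<and> u i = v i}" "{..<k - 1}"] by simp
  then have "hamming_dist N u v = N - k + 1"
    using agree[OF uv] assms(3,4) by (simp add: hamming_dist_eq_diff_agreements)
  then have attained: "N - k + 1 \<in> ?D"
    using uv by (smt (verit) mem_Collect_eq)
  show ?thesis
    unfolding min_dist_def
  proof (rule Min_eqI)
    show "finite ?D"
      by (rule finite_subset[of _ "{..N}"]) (auto simp: hamming_dist_eq_diff_agreements)
  next
    fix d assume "d \<in> ?D"
    then obtain u v where "d = hamming_dist N u v" "u \<in> C" "v \<in> C" "u \<noteq> v"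
      by blast
    then show "N - k + 1 \<le> d"
      using agree[of u v] assms(3,4) by (simp add: hamming_dist_eq_diff_agreements)
  qed (fact attained)
qed

section \<open>Zeros of a codeword\<close>

lemma normal_combination_eq_0_iff:
  fixes \<iota> :: "'k::{field,finite} \<Rightarrow> 'a::{field,finite}"
  assumes "field_hom \<iota>" and "normal_element \<iota> h \<omega>"
  shows "(\<Sum>i<h. \<iota> (c i) * \<omega> ^ (CARD('k) ^ i)) = 0 \<longleftrightarrow> (\<forall>i<h. c i = 0)"
proof
  interpret field_hom \<iota> by (fact assms(1))
  interpret vector_space "ext_scale \<iota>"
    by (rule vector_space_ext_scale) (fact assms(1))
  let ?b = "\<lambda>i. \<omega> ^ (CARD('k) ^ i)"
  have inj: "inj_on ?b {..<h}" and indep: "independent (?b ` {..<h})"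
    using assms(2) by (auto simp: normal_element_def)
  assume "(\<Sum>i<h. \<iota> (c i) * ?b i) = 0"
  then have "(\<Sum>v\<in>?b ` {..<h}. ext_scale \<iota> (c (inv_into {..<h} ?b v)) v) = 0"
    by (simp add: sum.reindex[OF inj] inv_into_f_f[OF inj] ext_scale_def)
  then have "c (inv_into {..<h} ?b v) = 0" if "v \<in> ?b ` {..<h}" for v
    using independentD[OF indep _ subset_refl _ that, of "\<lambda>v. c (inv_into {..<h} ?b v)"] by simp
  then show "\<forall>i<h. c i = 0"
    using inv_into_f_f[OF inj] by force
next
  interpret field_hom \<iota> by (fact assms(1))
  assume "\<forall>i<h. c i = 0"
  then show "(\<Sum>i<h. \<iota> (c i) * \<omega> ^ (CARD('k) ^ i)) = 0"
    by simp
qed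

text \<open>
  Orbits of a permutation that meet coincide, and an orbit of size \<open>h\<close> has only one representative.
\<close>

lemma frobenius_reps_disjoint_orbits:
  fixes \<Lambda> :: "'a::{field,finite} set"
  assumes reps: "frobenius_reps q h \<Lambda>" and perm: "permutation (\<lambda>y::'a. y ^ q)"
    and "x \<in> \<Lambda>" and "y \<in> \<Lambda>" and "x \<noteq> y"
  shows "orbit (\<lambda>y. y ^ q) x \<inter> orbit (\<lambda>y. y ^ q) y = {}"
proof (rule ccontr)
  let ?orb = "orbit (\<lambda>y. y ^ q)"
  assume "?orb x \<inter> ?orb y \<noteq> {}"
  then obtain z where z: "z \<in> ?orb x" "z \<in> ?orb y"
    by blast
  have self: "w \<in> ?orb w" for w :: 'a
    by (rule permutation_self_in_orbit[OF perm])
  have "x \<in> ?orb y"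
    using orbit_swap[OF self z(1)] z(2) by (rule orbit_trans)
  moreover have "\<exists>!r. r \<in> \<Lambda> \<and> r \<in> ?orb y"
    using reps \<open>y \<in> \<Lambda>\<close> by (simp add: frobenius_reps_def)
  ultimately show False
    using self[of y] assms(3-5) by blast
qed

text \<open>
  The zeros of \<open>f\<close> forced by vanishing coordinates are counted with multiplicity: the orbit of
  each \<open>\<alpha>_j\<close> supplies \<open>h\<close> distinct ones and each \<open>t_j\<close> one of order at least \<open>h\<close>, while a zero at
  infinity lowers the degree bound by \<open>h\<close>. Separation of the \<open>t_j\<close> from the orbits prevents double counting.
\<close>

lemma card_zeros_S_word_less:
  fixes \<iota> :: "'k::{field,finite} \<Rightarrow> 'a::{field,finite}"
  assumes hom: "field_hom \<iota>" and p: "prime p" and cardk: "CARD('k) = p ^ e"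
    and carda: "CARD('a) = p ^ d" and "h \<ge> 1" and "h \<le> p"
    and card_orb: "\<And>j. j < n \<Longrightarrow> card (orbit (\<lambda>y. y ^ CARD('k)) (\<alpha> j)) = h"
    and disj: "disjoint_family_on (\<lambda>j. orbit (\<lambda>y. y ^ CARD('k)) (\<alpha> j)) {..<n}"
    and inj: "inj_on t {..<m}"
    and sep: "\<And>i j. i < n \<Longrightarrow> j < m \<Longrightarrow> \<iota> (t j) \<notin> orbit (\<lambda>y. y ^ CARD('k)) (\<alpha> i)"
    and normal: "normal_element \<iota> h \<omega>" and "k \<ge> 1"
    and "f \<noteq> 0" and deg: "degree f < h * k"
  shows "card {j. j < n + m + 1 \<and> S_word \<iota> h k n m \<alpha> t \<omega> f j = 0} < k"
proof -
  interpret field_hom \<iota> by (fact hom)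
  interpret map_hom: map_poly_inj_idom_hom \<iota> ..
  let ?orb = "orbit (\<lambda>y. y ^ CARD('k))"
  define F where "F = map_poly \<iota> f"
  define A where "A = {j. j < n \<and> poly F (\<alpha> j) = 0}"
  define B where "B = {j. j < m \<and> (\<forall>i<h. poly ((pderiv ^^ i) f) (t j) = 0)}"
  define top_zero where "top_zero \<longleftrightarrow> (\<forall>i<h. coeff f (h * k - h + i) = 0)"
  define Z where "Z = (\<Union>j\<in>A. ?orb (\<alpha> j))"
  define T where "T = (\<lambda>j. \<iota> (t j)) ` B"
  have F: "F \<noteq> 0" "degree F = degree f"
    using \<open>f \<noteq> 0\<close> by (simp_all add: F_def)
  have fin: "finite A" "finite B" "finite {x. poly F x = 0}"
    using F(1) by (simp_all add: A_def B_def)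
  have Z_root: "poly F x = 0" if "x \<in> Z" for x
    using that poly_map_poly_frobenius_orbit[OF hom p cardk carda]
    unfolding Z_def A_def F_def by blast
  have "disjoint_family_on (\<lambda>j. ?orb (\<alpha> j)) A"
    using disj by (rule disjoint_family_on_mono[rotated]) (auto simp: A_def)
  then have "card Z = (\<Sum>j\<in>A. card (?orb (\<alpha> j)))"
    unfolding Z_def by (intro card_UN_disjoint fin) (auto simp: disjoint_family_on_def)
  then have card_Z: "card Z = h * card A"
    by (simp add: A_def card_orb mult.commute)
  have T_order: "h \<le> order x F" if x: "x \<in> T" for x
  proof -
    obtain j where j: "x = \<iota> (t j)" "j \<in> B"
      using x by (auto simp: T_def)
    have "[:-t j, 1:] ^ h dvd f"
      by (rule linear_power_dvdI_higher_pderiv)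
        (use j(2) \<open>h \<le> p\<close> in \<open>simp_all add: B_def CHAR_of_CARD_prime_power[OF p cardk]\<close>)
    then obtain g where "f = [:-t j, 1:] ^ h * g"
      by (rule dvdE)
    then have "F = [:-x, 1:] ^ h * map_poly \<iota> g"
      by (simp add: F_def j(1) map_hom.hom_mult map_hom.hom_power hom_distribs)
    then have "[:-x, 1:] ^ h dvd F"
      by simp
    then show ?thesis
      using F(1) by (simp only: order_divides) simp
  qed
  then have T_root: "poly F x = 0" if "x \<in> T" for x
    using that \<open>h \<ge> 1\<close> order_root[of F x] by fastforce
  have "inj_on (\<lambda>j. \<iota> (t j)) B"
    using inj by (auto simp: inj_on_def B_def)
  then have card_T: "card T = card B"
    unfolding T_def by (rule card_image)
  have "Z \<inter> T = {}"
    using sep by (auto simp: Z_def T_def A_def B_def)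
  have "h * card A + h * card B = (\<Sum>x\<in>Z. 1) + (\<Sum>x\<in>T. h)"
    by (simp add: card_Z card_T)
  also have "\<dots> \<le> (\<Sum>x\<in>Z. order x F) + (\<Sum>x\<in>T. order x F)"
  proof (intro add_mono sum_mono)
    show "1 \<le> order x F" if "x \<in> Z" for x
      using Z_root[OF that] F(1) order_root[of F x] by (simp add: Suc_le_eq)
  qed (rule T_order)
  also have "\<dots> = (\<Sum>x\<in>Z \<union> T. order x F)"
    using \<open>Z \<inter> T = {}\<close> by (simp add: sum.union_disjoint)
  also have "\<dots> \<le> (\<Sum>x | poly F x = 0. order x F)"
    using Z_root T_root by (intro sum_mono2 fin) auto
  also have "\<dots> \<le> degree f"
    using sum_order_le_degree[OF F(1)] F(2) by simp
  finally have roots: "h * (card A + card B) \<le> degree f"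
    by (simp add: algebra_simps)
  \<comment> \<open>Otherwise the leading coefficient would be among the top \<open>h\<close> coefficients.\<close>
  have "degree f < h * k - h" if top_zero
  proof (rule ccontr)
    assume *: "\<not> degree f < h * k - h"
    then have "degree f - (h * k - h) < h"
      using deg \<open>k \<ge> 1\<close> by (cases k) auto
    with that have "coeff f (h * k - h + (degree f - (h * k - h))) = 0"
      unfolding top_zero_def by blast
    with * \<open>f \<noteq> 0\<close> show False
      by simp
  qed
  with deg roots have "h * (card A + card B + (if top_zero then 1 else 0)) < h * k"
    by (auto simp: algebra_simps)
  then have less: "card A + card B + (if top_zero then 1 else 0) < k"
    by simp
  have "{j. j < n + m + 1 \<and> S_word \<iota> h k n m \<alpha> t \<omega> f j = 0}
      = A \<union> (\<lambda>j. n + j) ` B \<union> (if top_zero then {n + m} else {})" (is "?zeros = ?parts")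
  proof (rule Set.set_eqI)
    fix j
    consider "j < n" | i where "j = n + i" "i < m" | "j = n + m" | "j > n + m"
      by (metis add_less_cancel_left le_Suc_ex linorder_less_linear not_less)
    then show "j \<in> ?zeros \<longleftrightarrow> j \<in> ?parts"
      by cases
        (auto simp: S_word_def A_def B_def F_def top_zero_def
          normal_combination_eq_0_iff[OF hom normal])
  qed
  also have "card \<dots> \<le> card A + card B + (if top_zero then 1 else 0)"
    by (rule order.trans[OF card_Un_le] add_mono)+
      (auto simp: card_image)
  finally show ?thesis
    using less by simp
qed

section \<open>The code\<close>

lemma S_word_add:
  assumes "field_hom \<iota>"
  shows "S_word \<iota> h k n m \<alpha> t \<omega> (f + g)
    = S_word \<iota> h k n m \<alpha> t \<omega> f + S_word \<iota> h k n m \<alpha> t \<omega> g"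
proof -
  interpret field_hom \<iota> by (fact assms)
  show ?thesis
    by (auto simp: S_word_def fun_eq_iff hom_distribs higher_pderiv_add distrib_right sum.distrib)
qed

lemma S_word_smult:
  assumes "field_hom \<iota>"
  shows "S_word \<iota> h k n m \<alpha> t \<omega> (Polynomial.smult c f)
    = word_scale \<iota> c (S_word \<iota> h k n m \<alpha> t \<omega> f)"
proof -
  interpret field_hom \<iota> by (fact assms)
  show ?thesis
    by (auto simp: S_word_def fun_eq_iff hom_distribs higher_pderiv_smult word_scale_def
        ext_scale_def sum_distrib_left mult.assoc)
qed

lemma subspace_S_code:
  fixes \<iota> :: "'k::{field,finite} \<Rightarrow> 'a::{field,finite}"
  assumes hom: "field_hom \<iota>" and "h * k > 0"
  shows "module.subspace (word_scale \<iota>) (S_code \<iota> h k n m \<alpha> t \<omega>)"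
proof -
  interpret vector_space "word_scale \<iota>"
    by (rule vector_space_word_scale) (fact hom)
  let ?S = "S_word \<iota> h k n m \<alpha> t \<omega>"
  show ?thesis
  proof (rule subspaceI)
    have "?S 0 = 0"
      using S_word_add[OF hom, of h k n m \<alpha> t \<omega> 0 0] by simp
    then show "0 \<in> S_code \<iota> h k n m \<alpha> t \<omega>"
      using assms(2) by (auto simp: S_code_def intro!: exI[of _ 0])
  next
    fix u v
    assume "u \<in> S_code \<iota> h k n m \<alpha> t \<omega>" "v \<in> S_code \<iota> h k n m \<alpha> t \<omega>"
    then show "u + v \<in> S_code \<iota> h k n m \<alpha> t \<omega>"
      by (auto simp: S_code_def intro: degree_add_less simp flip: S_word_add[OF hom])
  next
    fix c u
    assume "u \<in> S_code \<iota> h k n m \<alpha> t \<omega>"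
    then show "word_scale \<iota> c u \<in> S_code \<iota> h k n m \<alpha> t \<omega>"
      by (auto simp: S_code_def intro: le_less_trans[OF degree_smult_le]
          simp flip: S_word_smult[OF hom])
  qed
qed

theorem theorem4p11:
  fixes \<iota> :: "'k::{field,finite} \<Rightarrow> 'a::{field,finite}"
    and p e q h k n m :: nat
    and \<Lambda> :: "'a set"
    and \<alpha> :: "nat \<Rightarrow> 'a"
    and t :: "nat \<Rightarrow> 'k"
    and \<omega> :: 'a
  assumes "h \<ge> 1"
    and "prime p" and "e \<ge> 1" and "q = p ^ e" and "p \<ge> h"
    and "CARD('k) = q" and "CARD('a) = q ^ h" and "field_hom \<iota>"
    and "frobenius_reps q h \<Lambda>"
    and "\<alpha> ` {..<n} \<subseteq> \<Lambda>" and "inj_on \<alpha> {..<n}"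
    and "inj_on t {..<m}"
    and "h = 1 \<longrightarrow> (\<forall>i<n. \<forall>j<m. \<alpha> i \<noteq> \<iota> (t j))"
    and "normal_element \<iota> h \<omega>"
    and "1 \<le> k" and "k < n" and "q \<ge> h * k + 1"
  shows "additive_code (n + m + 1) (S_code \<iota> h k n m \<alpha> t \<omega>) \<and>
         mds_code \<iota> h (n + m + 1) (S_code \<iota> h k n m \<alpha> t \<omega>)"
proof -
  note hom = \<open>field_hom \<iota>\<close> and p = \<open>prime p\<close> and reps = \<open>frobenius_reps q h \<Lambda>\<close>
  interpret \<iota>: field_hom \<iota> by (fact hom)
  interpret W: vector_space "word_scale \<iota>"
    by (rule vector_space_word_scale) (fact hom)
  let ?orb = "orbit (\<lambda>y::'a. y ^ q)"
  let ?S = "S_word \<iota> h k n m \<alpha> t \<omega>" and ?C = "S_code \<iota> h k n m \<alpha> t \<omega>" and ?N = "n + m + 1"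
  have cardk: "CARD('k) = p ^ e" and carda: "CARD('a) = p ^ (e * h)"
    using assms by (simp_all add: power_mult)
  have perm: "permutation (\<lambda>y::'a. y ^ q)"
    unfolding \<open>q = p ^ e\<close> using p carda by (rule permutation_frobenius)
  have \<alpha>_mem: "\<alpha> j \<in> \<Lambda>" if "j < n" for j
    using that assms(10) by blast
  then have card_orb: "card (?orb (\<alpha> j)) = h" if "j < n" for j
    using that reps by (simp add: frobenius_reps_def)
  have disj: "disjoint_family_on (\<lambda>j. ?orb (\<alpha> j)) {..<n}"
    using frobenius_reps_disjoint_orbits[OF reps perm] \<alpha>_mem \<open>inj_on \<alpha> {..<n}\<close>
    by (auto simp: disjoint_family_on_def inj_on_eq_iff)
  \<comment> \<open>An element of \<open>F_q\<close> is alone in its orbit, so it can meet an orbit of size \<open>h\<close> only if \<open>h = 1\<close>,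
    where the points are distinct by assumption.\<close>
  have sep: "\<iota> (t j) \<notin> ?orb (\<alpha> i)" if "i < n" "j < m" for i j
  proof
    assume "\<iota> (t j) \<in> ?orb (\<alpha> i)"
    moreover have "\<iota> (t j) ^ q = \<iota> (t j)"
      by (metis \<iota>.hom_power power_CARD_eq_self \<open>CARD('k) = q\<close>)
    then have "?orb (\<iota> (t j)) = {\<iota> (t j)}"
      by (simp add: orbit_eq_singleton_iff)
    ultimately have "\<alpha> i = \<iota> (t j)"
      using orbit_swap[OF permutation_self_in_orbit[OF perm]] by blast
    moreover from this have "h = 1"
      using card_orb[OF \<open>i < n\<close>] \<open>?orb (\<iota> (t j)) = {\<iota> (t j)}\<close> by simp
    ultimately show False
      using assms(13) that by blast
  qed
  have agree: "card {j. j < ?N \<and> ?S f j = ?S g j} < k"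
    if "degree f < h * k" "degree g < h * k" "f \<noteq> g" for f g
  proof -
    have "?S f = ?S (f - g) + ?S g"
      by (simp flip: S_word_add[OF hom])
    then have "{j. j < ?N \<and> ?S f j = ?S g j} = {j. j < ?N \<and> ?S (f - g) j = 0}"
      by simp
    also have "card \<dots> < k"
      using card_orb disj sep that assms
      by (intro card_zeros_S_word_less[OF hom p cardk carda] degree_diff_less) simp_all
    finally show ?thesis .
  qed
  have inj_S: "inj_on ?S {f. degree f < h * k}"
  proof (rule inj_onI)
    fix f g
    assume fg: "f \<in> {f. degree f < h * k}" "g \<in> {f. degree f < h * k}" "?S f = ?S g"
    show "f = g"
    proof (rule ccontr)
      assume "f \<noteq> g"
      \<comment> \<open>Equal words agree in all \<open>N > k\<close> coordinates.\<close>
      then have "?N < k"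
        using agree[of f g] fg by simp
      then show False
        using \<open>k < n\<close> by simp
    qed
  qed
  have C: "?C = ?S ` {f. degree f < h * k}"
    by (auto simp: S_code_def)
  have hk: "h * k > 0"
    using assms by simp
  have card_C: "card ?C = CARD('k) ^ (h * k)"
    unfolding C by (simp only: card_image[OF inj_S] card_degree_less[OF hk])
  have fin_C: "finite ?C"
    unfolding C by (rule finite_imageI) (rule card_degree_less[OF hk])
  have sub: "W.subspace ?C"
    using hom hk by (rule subspace_S_code)
  have words: "?C \<subseteq> words ?N"
    by (auto simp: S_code_def words_def S_word_def)
  have "q > 1"
    using assms(17) hk by linarith
  have "min_dist ?N ?C = ?N - k + 1"
  proof (rule min_dist_eqI_Singleton)
    show "CARD('a) > 1"
      unfolding \<open>CARD('a) = q ^ h\<close> using \<open>q > 1\<close> \<open>h \<ge> 1\<close> by (intro one_less_power) simp_all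
    show "card ?C = CARD('a) ^ k"
      using assms card_C by (simp add: power_mult)
    show "card {i. i < ?N \<and> u i = v i} < k" if "u \<in> ?C" "v \<in> ?C" "u \<noteq> v" for u v
      using that agree by (auto simp: C)
  qed (use fin_C assms in auto)
  then have "?N - min_dist ?N ?C + 1 = k"
    using \<open>1 \<le> k\<close> \<open>k < n\<close> by simp
  moreover have "CARD('k) ^ W.dim ?C = CARD('k) ^ (h * k)"
    using W.card_subspace_eq_power_dim[OF _ fin_C sub] card_C by simp
  moreover have "?C \<noteq> {0}"
  proof
    assume "?C = {0}"
    then have "CARD('k) ^ (h * k) = 1"
      using card_C by simp
    then show False
      using one_less_power[OF \<open>q > 1\<close> hk] \<open>CARD('k) = q\<close> by (metis less_irrefl)
  qed
  ultimately have "mds_code \<iota> h ?N ?C"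
    using words sub by (simp add: mds_code_def)
  moreover have "additive_code ?N ?C"
    unfolding additive_code_def
    using words W.subspace_add[OF sub] W.subspace_0[OF sub] by blast
  ultimately show ?thesis
    by blast
qed

end
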